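(* There is an absolute constant $c>0$ such that for every interval $\Delta=[a,b)\subset[0,1)$, every integer $l\ge1$ and every $0<\varepsilon<1$, the set $G=G_l(\Delta,\varepsilon)$ (defined in the context) satisfies $$|\{x\in[0,1): S^*(x,\mathbf 1_G)>\lambda\}|\le c\cdot\frac{|G|}{\lambda},\quad\lambda>0.$$
   Context: $|E|$ denotes Lebesgue measure and $\mathbf 1_E$ the indicator function of $E$. For $f\in L^1(0,1)$, $S_n(x,f)=\sum_{|k|\le n}\hat f(k)e^{2\pi ikx}$, with $\hat f(k)=\int_0^1f(t)e^{-2\pi ikt}dt$, is the $n$-th partial sum of the Fourier series of $f$ in the trigonometric system $\{e^{2\pi inx}\}$ on $[0,1)$, and $S^*(x,f)=\sup_{n\ge0}|S_n(x,f)|$. For an interval $\Delta=[a,b)\subset[0,1)$, an integer $l\ge1$ and $0<\varepsilon<1$, put $d=(b-a)/l$, $t_k=a+(2k-1)d/2$ (the center of $[a+(k-1)d,a+kd)$), $\delta_k=[t_k-d\varepsilon/2,\,t_k+d\varepsilon/2)$ for $k=1,\ldots,l$, and $G_l(\Delta,\varepsilon)=\bigcup_{k=1}^l\delta_k$. *)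

theory Defs
  imports "HOL-Analysis.Analysis"
begin

definition fourier_coeff :: "(real \<Rightarrow> complex) \<Rightarrow> int \<Rightarrow> complex" where
  "fourier_coeff f k =
     set_lebesgue_integral lebesgue {0..<1}
       (\<lambda>t. f t * exp (- (2 * of_real pi * \<i> * of_int k * of_real t)))"

definition fourier_partial_sum :: "nat \<Rightarrow> real \<Rightarrow> (real \<Rightarrow> complex) \<Rightarrow> complex" where
  "fourier_partial_sum n x f =
     (\<Sum>k\<in>{- int n..int n}.
        fourier_coeff f k * exp (2 * of_real pi * \<i> * of_int k * of_real x))"

(* Extended-real valued: the supremum may be infinite for a general integrable f,
   and the supremum of an unbounded set of reals is unspecified. *)
definition fourier_maximal :: "real \<Rightarrow> (real \<Rightarrow> complex) \<Rightarrow> ereal" where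
  "fourier_maximal x f = (SUP n. ereal (cmod (fourier_partial_sum n x f)))"

definition G_center :: "real \<Rightarrow> real \<Rightarrow> nat \<Rightarrow> nat \<Rightarrow> real" where
  "G_center a b l k = a + (2 * real k - 1) * ((b - a) / real l) / 2"

definition G_delta :: "real \<Rightarrow> real \<Rightarrow> nat \<Rightarrow> real \<Rightarrow> nat \<Rightarrow> real set" where
  "G_delta a b l \<epsilon> k =
     (let d = (b - a) / real l; t = G_center a b l k
      in {t - d * \<epsilon> / 2..<t + d * \<epsilon> / 2})"

definition G_set :: "nat \<Rightarrow> real \<Rightarrow> real \<Rightarrow> real \<Rightarrow> real set" where
  "G_set l a b \<epsilon> = (\<Union>k\<in>{1..l}. G_delta a b l \<epsilon> k)"

end

theory Submission
  imports Defs "HOL-Probability.Sinc_Integral"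
begin

text \<open>
  On \<open>\<bar>u\<bar> < 1\<close> the Dirichlet kernel differs from \<open>sin (N \<pi> u) / (\<pi> u)\<close>, \<open>N = 2 n + 1\<close>, by
  \<open>O(1 / (1 - \<bar>u\<bar>))\<close>, which costs \<open>O(\<bar>G\<bar> / min x (1 - x))\<close> in the partial sum at \<open>x\<close>.
  For \<open>x\<close> outside \<open>[a, b)\<close> the remaining integral is at most \<open>\<bar>G\<bar>\<close> divided by the distance to the
  interval.  For \<open>x\<close> inside, in cell \<open>k\<^sub>0\<close>, an interval \<open>\<delta>\<^sub>k\<close> with \<open>\<bar>k - k\<^sub>0\<bar> \<le> 1\<close> contributes
  \<open>O(\<epsilon> d / \<bar>x - t\<^sub>k\<bar>)\<close> because the sine integral is bounded.  In the others \<open>1 / (x - t)\<close> may be replaced by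
  \<open>1 / ((k\<^sub>0 - k) d)\<close> at the cost of \<open>O(\<epsilon>)\<close>; pairing \<open>k\<^sub>0 + j\<close> with \<open>k\<^sub>0 - j\<close> leaves
  \<open>\<epsilon> \<Sum> sin (j \<theta>) / j = O(\<epsilon>)\<close>, and the unpaired terms amount to
  \<open>O(\<bar>G\<bar> / min (x - a) (b - x))\<close>.  These bounds do not depend on \<open>n\<close>, and each of them exceeds a multiple
  of \<open>\<lambda>\<close> only on a set of measure \<open>O(\<bar>G\<bar> / \<lambda>)\<close>.
\<close>

subsection \<open>Partial sums of the sine series\<close>

text \<open>Induction with the addition formula. It controls the terms of the sine series with small
  index and shows that all of them vanish when \<open>sin x = 0\<close>.\<close>

lemma abs_sin_nat_mult_le: "\<bar>sin (real j * x)\<bar> \<le> real j * \<bar>sin x\<bar>"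
proof (induction j)
  case (Suc j)
  have "sin (real (Suc j) * x) = sin (real j * x) * cos x + cos (real j * x) * sin x"
    by (simp add: distrib_right sin_add)
  also have "\<bar>\<dots>\<bar> \<le> \<bar>sin (real j * x)\<bar> * \<bar>cos x\<bar> + \<bar>cos (real j * x)\<bar> * \<bar>sin x\<bar>"
    by (metis abs_mult abs_triangle_ineq)
  also have "\<dots> \<le> \<bar>sin (real j * x)\<bar> * 1 + 1 * \<bar>sin x\<bar>"
    by (intro add_mono mult_left_mono mult_right_mono) auto
  finally show ?case
    using Suc by (simp add: algebra_simps)
qed simp

text \<open>Summation by parts; the cosine term makes the induction close.\<close>

lemma sine_tail_by_parts:
  fixes x :: real
  assumes "p \<le> q"
  shows "\<bar>2 * sin (x / 2) * (\<Sum>j=Suc p..q. sin (real j * x) / real j)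
            + cos ((real q + 1 / 2) * x) / (real q + 1)\<bar>
         \<le> 2 / (real p + 1) - 1 / (real q + 1)"
  using assms
proof (induction q rule: dec_induct)
  case base
  have "\<bar>cos ((real p + 1 / 2) * x)\<bar> \<le> 1" by simp
  then have "\<bar>cos ((real p + 1 / 2) * x)\<bar> / (real p + 1) \<le> 1 / (real p + 1)"
    by (intro divide_right_mono) auto
  then show ?case by (simp add: field_simps)
next
  case (step q)
  define S where "S = (\<Sum>j=Suc p..q. sin (real j * x) / real j)"
  define c0 where "c0 = cos ((real q + 1 / 2) * x)"
  define c1 where "c1 = cos ((real q + 3 / 2) * x)"
  have prod: "2 * sin (x / 2) * sin (real (Suc q) * x) = c0 - c1"
  proof -
    have "c0 = cos (real (Suc q) * x - x / 2)" "c1 = cos (real (Suc q) * x + x / 2)"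
      by (simp_all add: c0_def c1_def algebra_simps)
    then show ?thesis by (simp add: cos_add cos_diff)
  qed
  have S: "(\<Sum>j=Suc p..Suc q. sin (real j * x) / real j) = S + sin (real (Suc q) * x) / (real q + 1)"
    using step(1) by (simp add: S_def add.commute)
  have "2 * sin (x / 2) * (\<Sum>j=Suc p..Suc q. sin (real j * x) / real j)
          + cos ((real (Suc q) + 1 / 2) * x) / (real (Suc q) + 1)
      = 2 * sin (x / 2) * S + (2 * sin (x / 2) * sin (real (Suc q) * x)) / (real q + 1) + c1 / (real q + 2)"
    unfolding S c1_def by (simp add: algebra_simps)
  \<comment> \<open>The boundary term moves from \<open>c0 / (real q + 1)\<close> to
    \<open>c1 / (real q + 2)\<close>; what is left over is \<open>c1\<close> times a difference of
    consecutive reciprocals, which the right-hand side absorbs exactly.\<close>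
  also have "\<dots> = (2 * sin (x / 2) * S + c0 / (real q + 1)) - c1 * (1 / (real q + 1) - 1 / (real q + 2))"
    unfolding prod by (simp add: algebra_simps diff_divide_distrib)
  also have "\<bar>\<dots>\<bar> \<le> \<bar>2 * sin (x / 2) * S + c0 / (real q + 1)\<bar> + \<bar>c1 * (1 / (real q + 1) - 1 / (real q + 2))\<bar>"
    by (rule abs_triangle_ineq4)
  also have "\<dots> \<le> (2 / (real p + 1) - 1 / (real q + 1)) + (1 / (real q + 1) - 1 / (real q + 2))"
  proof (rule add_mono)
    have "0 \<le> 1 / (real q + 1) - 1 / (real q + 2)" by (simp add: field_simps)
    moreover have "\<bar>c1\<bar> \<le> 1" by (simp add: c1_def)
    ultimately show "\<bar>c1 * (1 / (real q + 1) - 1 / (real q + 2))\<bar> \<le> 1 / (real q + 1) - 1 / (real q + 2)"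
      by (simp add: abs_mult mult_left_le_one_le)
  qed (use step(3) S_def c0_def in simp)
  finally show ?case by (simp add: add.commute)
qed

text \<open>The sum is cut near j = 1/s, where s is the modulus of \<open>sin (x / 2)\<close>. Below
  the cut each term is at most 2 s and there are at most 1/s of them, which gives 2; above it,
  summation by parts leaves at most 1 / (s (p + 1)) \<le> 1.\<close>

lemma abs_sine_series_partial_sum_le:
  "\<bar>\<Sum>j=1..m. sin (real j * x) / real j\<bar> \<le> 3"
proof (cases "sin (x / 2) = 0")
  case True
  have "sin x = 0" using sin_double[of "x / 2"] True by simp
  then have "sin (real j * x) = 0" for j
    using abs_sin_nat_mult_le[of j x] by simp
  then show ?thesis by simp
next
  case False
  define s where "s = \<bar>sin (x / 2)\<bar>"
  have s: "0 < s" using False by (simp add: s_def)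
  \<comment> \<open>The minimum covers sums that end before the cut: then \<open>p = m\<close> and
    the tail is empty.\<close>
  define p where "p = min m (nat \<lfloor>1 / s\<rfloor>)"
  have pm: "p \<le> m" by (simp add: p_def)
  have "real (nat \<lfloor>1 / s\<rfloor>) \<le> 1 / s"
    using s by simp
  then have ps: "real p \<le> 1 / s" by (simp add: p_def)
  have head: "\<bar>\<Sum>j=1..p. sin (real j * x) / real j\<bar> \<le> 2"
  proof -
    have "\<bar>sin (real j * x) / real j\<bar> \<le> 2 * s" if "j \<in> {1..p}" for j
    proof -
      have "\<bar>sin x\<bar> = 2 * s * \<bar>cos (x / 2)\<bar>"
        using sin_double[of "x / 2"] by (simp add: s_def abs_mult)
      also have "\<dots> \<le> 2 * s * 1" using s by (intro mult_left_mono) auto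
      finally have "real j * \<bar>sin x\<bar> \<le> real j * (2 * s)" by (intro mult_left_mono) auto
      with abs_sin_nat_mult_le[of j x] have "\<bar>sin (real j * x)\<bar> \<le> real j * (2 * s)" by linarith
      then show ?thesis using that by (simp add: field_simps)
    qed
    then have "(\<Sum>j=1..p. \<bar>sin (real j * x) / real j\<bar>) \<le> real (card {1..p}) * (2 * s)"
      by (rule sum_bounded_above)
    also have "\<dots> \<le> 2" using ps s by (simp add: field_simps)
    finally show ?thesis using sum_abs[of "\<lambda>j. sin (real j * x) / real j" "{1..p}"] by linarith
  qed
  have tail: "\<bar>\<Sum>j=Suc p..m. sin (real j * x) / real j\<bar> \<le> 1"
  proof (cases "p = m")
    case False
    then have "p = nat \<lfloor>1 / s\<rfloor>" by (simp add: p_def min_def split: if_splits)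
    then have p1: "1 / s \<le> real p + 1" using s by linarith
    define T where "T = (\<Sum>j=Suc p..m. sin (real j * x) / real j)"
    have "\<bar>cos ((real m + 1 / 2) * x)\<bar> \<le> 1" by simp
    then have "\<bar>cos ((real m + 1 / 2) * x)\<bar> / (real m + 1) \<le> 1 / (real m + 1)"
      by (intro divide_right_mono) auto
    then have "\<bar>cos ((real m + 1 / 2) * x) / (real m + 1)\<bar> \<le> 1 / (real m + 1)"
      by simp
    with sine_tail_by_parts[OF pm, of x] have "\<bar>2 * sin (x / 2) * T\<bar> \<le> 2 / (real p + 1)"
      unfolding T_def by linarith
    then have "s * \<bar>T\<bar> \<le> 1 / (real p + 1)" by (simp add: s_def abs_mult)
    also have "\<dots> \<le> s" using p1 s by (simp add: field_simps)
    finally show ?thesis using s by (simp add: T_def)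
  qed simp
  have "(\<Sum>j=1..m. sin (real j * x) / real j)
      = (\<Sum>j=1..p. sin (real j * x) / real j) + (\<Sum>j=Suc p..m. sin (real j * x) / real j)"
    using pm sum.ub_add_nat[of 1 p "\<lambda>j. sin (real j * x) / real j" "m - p"] by simp
  with head tail show ?thesis by linarith
qed

subsection \<open>The Dirichlet and sinc kernels\<close>

definition dirichlet_kernel :: "nat \<Rightarrow> real \<Rightarrow> real" where
  "dirichlet_kernel n u = 1 + 2 * (\<Sum>k=1..n. cos (2 * pi * real k * u))"

text \<open>For u different from 0 this is \<open>sin (N * pi * u) / (pi * u)\<close>. Writing it
  with \<open>sinc\<close> fills in the value N at 0, so the kernel is continuous and its integrals
  are differences of \<open>Si\<close>.\<close>

definition sinc_kernel :: "real \<Rightarrow> real \<Rightarrow> real" where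
  "sinc_kernel N u = N * sinc (N * pi * u)"

lemma continuous_dirichlet_kernel [continuous_intros]:
  fixes f :: "'a::t2_space \<Rightarrow> real"
  shows "continuous_on S f \<Longrightarrow> continuous_on S (\<lambda>x. dirichlet_kernel n (f x))"
  unfolding dirichlet_kernel_def by (auto intro!: continuous_intros)

lemma continuous_sinc_kernel [continuous_intros]:
  fixes f :: "'a::t2_space \<Rightarrow> real"
  shows "continuous_on S f \<Longrightarrow> continuous_on S (\<lambda>x. sinc_kernel N (f x))"
  unfolding sinc_kernel_def by (intro continuous_intros)

text \<open>The product-to-sum formula makes the terms telescope. Kept as a product, the identity
  also holds at the zeros of \<open>sin (pi * u)\<close>.\<close>

lemma sin_mult_dirichlet_kernel:
  "sin (pi * u) * dirichlet_kernel n u = sin ((2 * real n + 1) * pi * u)"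
proof (induction n)
  case (Suc n)
  have "sin (pi * u) * dirichlet_kernel (Suc n) u
      = sin (pi * u) * dirichlet_kernel n u + 2 * sin (pi * u) * cos (2 * pi * real (Suc n) * u)"
    by (simp add: dirichlet_kernel_def algebra_simps)
  also have "\<dots> = sin ((2 * real n + 1) * pi * u)
      + (sin (pi * u + 2 * pi * real (Suc n) * u) + sin (pi * u - 2 * pi * real (Suc n) * u))"
    unfolding Suc by (simp add: sin_add sin_diff)
  also have "pi * u - 2 * pi * real (Suc n) * u = - ((2 * real n + 1) * pi * u)"
    by (simp add: algebra_simps)
  also have "pi * u + 2 * pi * real (Suc n) * u = (2 * real (Suc n) + 1) * pi * u"
    by (simp add: algebra_simps)
  finally show ?case by (simp only: sin_minus)
qed (simp add: dirichlet_kernel_def)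

lemma exp_sum_eq_dirichlet_kernel:
  "(\<Sum>k\<in>{- int n..int n}. exp (2 * of_real pi * \<i> * of_int k * of_real u))
     = complex_of_real (dirichlet_kernel n u)"
proof (induction n)
  case (Suc n)
  have *: "{- int (Suc n)..int (Suc n)} = insert (- int (Suc n)) (insert (int (Suc n)) {- int n..int n})"
    by auto
  have cis: "exp (2 * of_real pi * \<i> * of_int k * of_real u) = cis (2 * pi * of_int k * u)" for k
    by (simp add: cis_conv_exp mult_ac)
  have "cis (2 * pi * of_int (- int (Suc n)) * u) + cis (2 * pi * of_int (int (Suc n)) * u)
      = complex_of_real (2 * cos (2 * pi * real (Suc n) * u))"
  proof -
    have "2 * pi * of_int (- int (Suc n)) * u = - (2 * pi * real (Suc n) * u)"
      by (simp only: of_int_minus of_int_of_nat_eq mult_minus_left mult_minus_right)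
    moreover have "2 * pi * of_int (int (Suc n)) * u = 2 * pi * real (Suc n) * u"
      by (simp only: of_int_of_nat_eq)
    ultimately show ?thesis by (simp only: complex_eq_iff plus_complex.sel cis.sel
        complex_of_real_def complex.sel cos_minus sin_minus mult_2 add.left_inverse)
  qed
  then show ?case
    using Suc unfolding * cis
    by (simp add: dirichlet_kernel_def algebra_simps)
qed (simp add: dirichlet_kernel_def)

section \<open>Comparison of the Dirichlet and sinc kernels\<close>

lemma sin_ge_minus_cube:
  fixes x :: real
  assumes "0 \<le> x"
  shows "x - x ^ 3 / 6 \<le> sin x"
proof -
  have "\<bar>sin x - (\<Sum>m<3. sin_coeff m * x ^ m)\<bar> \<le> inverse (fact 3) * \<bar>x\<bar> ^ 3"
    by (rule Maclaurin_sin_bound)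
  moreover have "(\<Sum>m<3. sin_coeff m * x ^ m) = x"
    by (simp add: numeral_eq_Suc sin_coeff_def)
  moreover have "inverse (fact 3) * \<bar>x\<bar> ^ 3 = x ^ 3 / 6"
    using assms by (simp add: fact_numeral field_simps)
  ultimately show ?thesis by linarith
qed

text \<open>The product is at most the distance from u to the nearer endpoint, and
  \<open>sin (pi * u)\<close>, symmetric about 1/2, dominates that distance. The factor
  \<open>1 - u\<close> records the second zero, where the Dirichlet kernel peaks again.\<close>

lemma sin_pi_mult_ge:
  assumes "0 \<le> u" "u \<le> 1"
  shows "u * (1 - u) \<le> sin (pi * u)"
proof -
  have half: "v \<le> sin (pi * v)" if "0 \<le> v" "v \<le> 1 / 2" for v
  proof -
    have "0 \<le> pi * v" using that by simp
    \<comment> \<open>The number 1.6 exceeds \<open>pi / 2\<close>, and its square divided by 6 is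
      below 1/2, so the cubic term takes away at most half of \<open>pi * v\<close>.\<close>
    then have y: "0 \<le> pi * v" "pi * v \<le> 1.6"
      using mult_mono[of pi "3.2" v "1/2"] that pi_approx by auto
    have "(pi * v) ^ 3 / 6 = (pi * v) * (pi * v)\<^sup>2 / 6" by (simp add: power3_eq_cube power2_eq_square)
    also have "\<dots> \<le> (pi * v) * 1.6\<^sup>2 / 6"
      using y by (intro divide_right_mono mult_left_mono power_mono) auto
    finally have "(pi * v) ^ 3 / 6 \<le> (pi * v) / 2" using y by (simp add: power2_eq_square)
    moreover have "pi * v - (pi * v) ^ 3 / 6 \<le> sin (pi * v)"
      using sin_ge_minus_cube y by simp
    moreover have "3 * v \<le> pi * v" using pi_approx that by (intro mult_right_mono) auto
    ultimately show ?thesis using that by linarith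
  qed
  show ?thesis
  proof (cases "u \<le> 1 / 2")
    case True
    have "u * (1 - u) \<le> u" using assms by (simp add: mult_left_le)
    with half[of u] True assms show ?thesis by linarith
  next
    case False
    have "u * (1 - u) \<le> 1 - u" using assms by (simp add: mult_left_le_one_le)
    moreover have "sin (pi * (1 - u)) = sin (pi * u)"
      using sin_pi_minus[of "pi * u"] by (simp add: algebra_simps)
    ultimately show ?thesis using half[of "1 - u"] False assms by simp
  qed
qed

text \<open>Both kernels have the same numerator, and 1 / sin(pi v) - 1 / (pi v) stays bounded near
  0 because pi v - sin(pi v) = O(v^3). Only the zero of the sine at v = 1 remains, and the bound
  does not involve n.\<close>

lemma dirichlet_sinc_kernel_diff:
  assumes "\<bar>u\<bar> < 1"
  shows "\<bar>dirichlet_kernel n u - sinc_kernel (2 * real n + 1) u\<bar> \<le> 2 / (1 - \<bar>u\<bar>)"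
proof -
  define N where "N = 2 * real n + 1"
  have pos: "\<bar>dirichlet_kernel n v - sinc_kernel N v\<bar> \<le> 2 / (1 - v)" if v: "0 < v" "v < 1" for v
  proof -
    define s where "s = sin (pi * v)"
    have s: "v * (1 - v) \<le> s" using sin_pi_mult_ge[of v] v by (simp add: s_def)
    have "0 < v * (1 - v)" using v by simp
    with s have s0: "0 < s" by linarith
    have s1: "s \<le> pi * v" unfolding s_def using v by (intro sin_x_le_x) simp
    have "dirichlet_kernel n v = sin (N * pi * v) / s"
      using sin_mult_dirichlet_kernel[of v n] s0 by (simp add: N_def s_def field_simps)
    moreover have "sinc_kernel N v = sin (N * pi * v) / (pi * v)"
      using v by (simp add: sinc_kernel_def N_def)
    ultimately have "dirichlet_kernel n v - sinc_kernel N v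
        = sin (N * pi * v) / s - sin (N * pi * v) / (pi * v)" by simp
    also have "\<dots> = sin (N * pi * v) * ((pi * v - s) / (pi * v * s))"
      using s0 v by (simp add: field_simps)
    also have "\<bar>\<dots>\<bar> \<le> 1 * \<bar>(pi * v - s) / (pi * v * s)\<bar>"
      unfolding abs_mult by (intro mult_right_mono) auto
    also have "\<dots> = (pi * v - s) / (pi * v * s)" using s0 s1 v by simp
    also have "\<dots> \<le> ((pi * v) ^ 3 / 6) / (pi * v * (v * (1 - v)))"
    proof (rule frac_le)
      show "pi * v - s \<le> (pi * v) ^ 3 / 6"
        using sin_ge_minus_cube[of "pi * v"] v by (simp add: s_def)
      show "pi * v * (v * (1 - v)) \<le> pi * v * s" using s v by (intro mult_left_mono) auto
    qed (use v in auto)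
    also have "\<dots> = pi\<^sup>2 / 6 * v / (1 - v)"
      using v by (simp add: field_simps power2_eq_square power3_eq_cube)
    also have "\<dots> \<le> 2 * 1 / (1 - v)"
    proof (intro divide_right_mono mult_mono)
      have "pi\<^sup>2 \<le> 3.2\<^sup>2" using pi_approx by (intro power_mono) auto
      then show "pi\<^sup>2 / 6 \<le> 2" by (simp add: power2_eq_square)
    qed (use v in auto)
    finally show ?thesis by simp
  qed
  have even: "dirichlet_kernel n (- v) = dirichlet_kernel n v" "sinc_kernel N (- v) = sinc_kernel N v" for v
    by (simp_all add: dirichlet_kernel_def sinc_kernel_def)
  consider "u = 0" | "0 < u" | "u < 0" by linarith
  then show ?thesis
  proof cases
    case 1
    then show ?thesis by (simp add: dirichlet_kernel_def sinc_kernel_def)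
  next
    case 2
    then show ?thesis using pos[of u] assms by (simp add: N_def)
  next
    case 3
    then show ?thesis using pos[of "- u"] assms even[of u] by (simp add: N_def)
  qed
qed

section \<open>Size and integrals of the sinc kernel\<close>

lemma abs_sinc_kernel_le: "\<bar>sinc_kernel N u\<bar> \<le> 1 / (pi * \<bar>u\<bar>)" if "u \<noteq> 0"
proof (cases "N = 0")
  case False
  have "\<bar>sinc_kernel N u\<bar> = \<bar>sin (N * pi * u)\<bar> / (pi * \<bar>u\<bar>)"
    using that False by (simp add: sinc_kernel_def abs_mult)
  also have "\<dots> \<le> 1 / (pi * \<bar>u\<bar>)" by (intro divide_right_mono) auto
  finally show ?thesis .
qed (simp add: sinc_kernel_def)

lemma sinc_kernel_has_integral:
  assumes "\<alpha> \<le> \<beta>"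
  shows "((\<lambda>t. sinc_kernel N (x - t)) has_integral
            (Si (N * pi * (x - \<alpha>)) - Si (N * pi * (x - \<beta>))) / pi) {\<alpha>..\<beta>}"
proof -
  have D: "((\<lambda>t. - Si (N * pi * (x - t)) / pi) has_vector_derivative sinc_kernel N (x - t))
          (at t within {\<alpha>..\<beta>})" for t
  proof -
    have "((\<lambda>t. N * pi * (x - t)) has_real_derivative - (N * pi)) (at t)"
      by (auto intro!: derivative_eq_intros)
    from DERIV_chain2[OF DERIV_Si this]
    have "((\<lambda>t. Si (N * pi * (x - t))) has_real_derivative
        sinc (N * pi * (x - t)) * - (N * pi)) (at t)" .
    from DERIV_cdivide[OF DERIV_minus[OF this], of pi]
    have "((\<lambda>t. - Si (N * pi * (x - t)) / pi) has_real_derivative sinc_kernel N (x - t)) (at t)"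
      unfolding sinc_kernel_def by (rule DERIV_cong) simp
    then show ?thesis
      using has_real_derivative_iff_has_vector_derivative has_vector_derivative_at_within by blast
  qed
  from fundamental_theorem_of_calculus[OF assms D] show ?thesis
    by (simp add: diff_divide_distrib)
qed

text \<open>If x is at least 2 h away from t, the kernel is at most 1 / |x - t| on the whole
  interval. Otherwise the bound on \<open>Si\<close> gives at most B, and 2 h / |x - t| > 1 brings
  this to the same form. Neither case depends on N.\<close>

lemma sinc_kernel_integral_single:
  assumes B: "\<And>T. \<bar>Si T\<bar> \<le> B" and h: "0 < h" and x: "x \<noteq> t"
  shows "\<bar>integral {t - h..t + h} (\<lambda>s. sinc_kernel N (x - s))\<bar> \<le> (2 * B + 2) * h / \<bar>x - t\<bar>"
proof -
  have B0: "0 \<le> B" using B[of 0] by linarith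
  show ?thesis
  proof (cases "2 * h \<le> \<bar>x - t\<bar>")
    case True
    have "\<bar>sinc_kernel N (x - s)\<bar> \<le> 1 / \<bar>x - t\<bar>" if "s \<in> {t - h..t + h}" for s
    proof -
      have far: "\<bar>x - t\<bar> / 2 \<le> \<bar>x - s\<bar>" using that True by (auto simp: abs_if split: if_splits)
      then have "x - s \<noteq> 0" using x by auto
      then have "\<bar>sinc_kernel N (x - s)\<bar> \<le> 1 / (pi * \<bar>x - s\<bar>)" by (rule abs_sinc_kernel_le)
      \<comment> \<open>Here \<open>pi\<close> \<ge> 2 compensates for the halved distance.\<close>
      also have "\<dots> \<le> 1 / (2 * (\<bar>x - t\<bar> / 2))"
        using far x \<open>x - s \<noteq> 0\<close> pi_approx by (intro frac_le mult_mono) auto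
      finally show ?thesis by simp
    qed
    then have "norm (integral {t - h..t + h} (\<lambda>s. sinc_kernel N (x - s))) \<le> 1 / \<bar>x - t\<bar> * (t + h - (t - h))"
      using h by (intro integral_bound) (auto intro!: continuous_intros)
    also have "\<dots> \<le> (2 * B + 2) * h / \<bar>x - t\<bar>"
      using B0 h x by (simp add: field_simps)
    finally show ?thesis by simp
  next
    case False
    have "integral {t - h..t + h} (\<lambda>s. sinc_kernel N (x - s))
        = (Si (N * pi * (x - (t - h))) - Si (N * pi * (x - (t + h)))) / pi"
      using h by (intro integral_unique sinc_kernel_has_integral) simp
    also have "\<bar>\<dots>\<bar> \<le> 2 * B / pi"
      using B[of "N * pi * (x - (t - h))"] B[of "N * pi * (x - (t + h))"]
      by (simp add: divide_right_mono)
    also have "\<dots> \<le> B" using B0 pi_approx by (simp add: field_simps) (simp add: mult_left_mono)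
    also have "\<dots> \<le> B * (2 * h / \<bar>x - t\<bar>)"
      using False x B0 by (intro mult_le_cancel_left1[THEN iffD2]) (auto simp: field_simps)
    also have "\<dots> \<le> (2 * B + 2) * h / \<bar>x - t\<bar>"
      using B0 h x by (simp add: field_simps)
    finally show ?thesis .
  qed
qed

subsection \<open>Sums over equally spaced intervals\<close>

lemma sinc_kernel_minus [simp]: "sinc_kernel N (- u) = sinc_kernel N u"
  by (simp add: sinc_kernel_def)

text \<open>Only the denominator is frozen at j d; the phase of the sine is kept. With u = y + j d
  \<ge> (j - 1) d the error is at most |y| / (u j d) \<le> 1 / ((j - 1) j d), written as a
  difference so that the sum over j telescopes.\<close>

lemma sinc_kernel_shift_approx:
  assumes d: "0 < d" and y: "\<bar>y\<bar> \<le> d" and j: "2 \<le> j" and N: "N \<noteq> 0"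
  shows "\<bar>sinc_kernel N (y + real j * d) - sin (N * pi * (y + real j * d)) / (pi * real j * d)\<bar>
          \<le> (1 / (real j - 1) - 1 / real j) / d"
proof -
  define u where "u = y + real j * d"
  have "d * (real j - 1) \<le> u" using y by (simp add: u_def algebra_simps)
  moreover have "0 < d * (real j - 1)" using d j by simp
  ultimately have u: "d * (real j - 1) \<le> u" "0 < u" by linarith+
  have "sinc_kernel N u - sin (N * pi * u) / (pi * real j * d)
      = sin (N * pi * u) / (pi * u) - sin (N * pi * u) / (pi * (real j * d))"
    using u N by (simp add: sinc_kernel_def)
  also have "\<dots> = sin (N * pi * u) * ((real j * d - u) / (pi * u * (real j * d)))"
    using u d j by (simp add: divide_simps) (simp add: algebra_simps)
  also have "\<bar>\<dots>\<bar> \<le> 1 * \<bar>(real j * d - u) / (pi * u * (real j * d))\<bar>"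
    unfolding abs_mult by (intro mult_right_mono) auto
  also have "\<dots> = \<bar>y\<bar> / (pi * u * (real j * d))"
    using u d by (simp add: u_def abs_mult)
  also have "\<dots> \<le> d / (1 * (d * (real j - 1)) * (real j * d))"
    using u d y j pi_ge_two by (intro frac_le mult_mono mult_pos_pos) auto
  also have "\<dots> = (1 / (real j - 1) - 1 / real j) / d"
    using d j by (simp add: divide_simps)
  finally show ?thesis by (simp add: u_def)
qed

lemma sum_telescope_le_one: "(\<Sum>j=2..p. 1 / (real j - 1) - 1 / real j) \<le> 1"
proof (cases "p < 2")
  case False
  then have "1 \<le> p" by simp
  then have "(\<Sum>j=2..p. 1 / (real j - 1) - 1 / real j) = 1 - 1 / real p"
  proof (induction p rule: dec_induct)
    case (step p)
    then show ?case by (simp add: sum.atLeast_Suc_atMost[symmetric] atLeastAtMostSuc_conv)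
  qed simp
  then show ?thesis by simp
qed simp

lemma sinc_kernel_half_sum_approx:
  assumes "0 < d" "\<bar>y\<bar> \<le> d" "N \<noteq> 0"
  shows "\<bar>(\<Sum>j=2..p. sinc_kernel N (y + real j * d))
            - (\<Sum>j=2..p. sin (N * pi * (y + real j * d)) / (pi * real j * d))\<bar> \<le> 1 / d"
proof -
  have "\<bar>\<Sum>j=2..p. sinc_kernel N (y + real j * d) - sin (N * pi * (y + real j * d)) / (pi * real j * d)\<bar>
      \<le> (\<Sum>j=2..p. (1 / (real j - 1) - 1 / real j) / d)"
    using assms by (intro order_trans[OF sum_abs] sum_mono sinc_kernel_shift_approx) auto
  also have "\<dots> \<le> 1 / d"
    using sum_telescope_le_one[of p] assms
    by (simp add: sum_divide_distrib[symmetric] divide_right_mono)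
  finally show ?thesis by (simp add: sum_subtractf)
qed

text \<open>There are at most p dropped terms, each at most C / (m + 1). This crude count is of the
  right kind: p / (m + 1) later becomes a constant times the length of the interval over the
  distance to its nearer endpoint.\<close>

lemma sum_tail_harmonic_le:
  fixes g :: "nat \<Rightarrow> real"
  assumes "m \<le> p" and g: "\<And>j. 2 \<le> j \<Longrightarrow> \<bar>g j\<bar> \<le> C / real j" and C: "0 \<le> C"
  shows "\<bar>(\<Sum>j=2..p. g j) - (\<Sum>j=2..m. g j)\<bar> \<le> C * real p / (real m + 1)"
proof -
  have sub: "{2..m} \<subseteq> {2..p}" using assms by auto
  have "(\<Sum>j=2..p. g j) - (\<Sum>j=2..m. g j) = (\<Sum>j\<in>{2..p} - {2..m}. g j)"
    using sub by (simp add: sum_diff)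
  also have "\<bar>\<dots>\<bar> \<le> (\<Sum>j\<in>{2..p} - {2..m}. \<bar>g j\<bar>)" by (rule sum_abs)
  also have "\<dots> \<le> real (card ({2..p} - {2..m})) * (C / (real m + 1))"
  proof (rule sum_bounded_above)
    fix j assume "j \<in> {2..p} - {2..m}"
    then have j: "2 \<le> j" "m + 1 \<le> j" by auto
    then have "real m + 1 \<le> real j" by linarith
    then have "C / real j \<le> C / (real m + 1)" using C by (intro divide_left_mono) auto
    with g[OF j(1)] show "\<bar>g j\<bar> \<le> C / (real m + 1)" by linarith
  qed
  also have "\<dots> \<le> real p * (C / (real m + 1))"
  proof (intro mult_right_mono)
    have "card ({2..p} - {2..m}) \<le> card {2..p}" by (intro card_mono) auto
    then show "real (card ({2..p} - {2..m})) \<le> real p" by simp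
  qed (use C in auto)
  finally show ?thesis by (simp add: mult.commute)
qed

text \<open>After freezing the denominators, the terms for j on both sides are paired up to m = min
  p q. A pair equals a factor free of j times sin(j \<theta>) / j with \<theta> = N pi d. Of the 6,
  freezing costs 1 on each side and the paired sine sum costs 4; the quotient pays for the unpaired
  terms.\<close>

lemma sinc_kernel_lattice_sum_le:
  assumes d: "0 < d" and y: "\<bar>y\<bar> \<le> d" and N: "N \<noteq> 0"
  shows "\<bar>(\<Sum>j=2..p. sinc_kernel N (y + real j * d)) + (\<Sum>j=2..q. sinc_kernel N (y - real j * d))\<bar>
          \<le> (6 + real (p + q) / (real (min p q) + 1)) / d"
proof -
  define m where "m = min p q"
  define g where "g z j = sin (N * pi * (z + real j * d)) / (pi * real j * d)" for z and j :: nat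
  have g: "\<bar>g z j\<bar> \<le> (1 / d) / real j" if "2 \<le> j" for z j
  proof -
    have "\<bar>g z j\<bar> = \<bar>sin (N * pi * (z + real j * d))\<bar> / (pi * real j * d)"
      using d by (simp add: g_def abs_mult)
    also have "\<dots> \<le> 1 / (1 * real j * d)"
      using d that pi_ge_two by (intro frac_le mult_mono mult_pos_pos) auto
    finally show ?thesis by (simp add: mult.commute)
  qed
  \<comment> \<open>Evenness reflects the second sum into one of the first kind, with -y in place of
    y.\<close>
  have neg: "sinc_kernel N (y - real j * d) = sinc_kernel N (- y + real j * d)" for j
    using sinc_kernel_minus[of N "y - real j * d"] by simp
  have 1: "\<bar>(\<Sum>j=2..p. sinc_kernel N (y + real j * d)) - (\<Sum>j=2..p. g y j)\<bar> \<le> 1 / d"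
    unfolding g_def using sinc_kernel_half_sum_approx[OF d y N] by simp
  have 2: "\<bar>(\<Sum>j=2..q. sinc_kernel N (y - real j * d)) - (\<Sum>j=2..q. g (- y) j)\<bar> \<le> 1 / d"
    unfolding g_def neg using sinc_kernel_half_sum_approx[OF d _ N, of "- y"] y by simp
  have 3: "\<bar>(\<Sum>j=2..p. g y j) - (\<Sum>j=2..m. g y j)\<bar> \<le> 1 / d * real p / (real m + 1)"
    using g d by (intro sum_tail_harmonic_le) (auto simp: m_def)
  have 4: "\<bar>(\<Sum>j=2..q. g (- y) j) - (\<Sum>j=2..m. g (- y) j)\<bar> \<le> 1 / d * real q / (real m + 1)"
    using g d by (intro sum_tail_harmonic_le) (auto simp: m_def)
  have 5: "\<bar>(\<Sum>j=2..m. g y j) + (\<Sum>j=2..m. g (- y) j)\<bar> \<le> 4 / d"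
  proof -
    define T where "T = (\<Sum>j=2..m. sin (real j * (N * pi * d)) / real j)"
    have "g y j + g (- y) j = 2 * cos (N * pi * y) / (pi * d) * (sin (real j * (N * pi * d)) / real j)"
      if "j \<in> {2..m}" for j
    proof -
      have "N * pi * (y + real j * d) = real j * (N * pi * d) + N * pi * y"
           "N * pi * (- y + real j * d) = real j * (N * pi * d) - N * pi * y"
        by (simp_all add: algebra_simps)
      then have "g y j + g (- y) j
          = (sin (real j * (N * pi * d) + N * pi * y) + sin (real j * (N * pi * d) - N * pi * y)) / (pi * real j * d)"
        unfolding g_def by (simp only: add_divide_distrib)
      also have "sin (real j * (N * pi * d) + N * pi * y) + sin (real j * (N * pi * d) - N * pi * y)
          = 2 * cos (N * pi * y) * sin (real j * (N * pi * d))"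
        by (simp only: sin_add sin_diff) simp
      finally show ?thesis by (simp add: mult_ac)
    qed
    then have "(\<Sum>j=2..m. g y j) + (\<Sum>j=2..m. g (- y) j) = 2 * cos (N * pi * y) / (pi * d) * T"
      unfolding T_def sum.distrib[symmetric] sum_distrib_left by (intro sum.cong) auto
    also have "\<bar>\<dots>\<bar> = \<bar>cos (N * pi * y)\<bar> * (2 / (pi * d)) * \<bar>T\<bar>"
      using d by (simp add: abs_mult)
    also have "\<dots> \<le> 1 * (2 / (2 * d)) * 4"
    proof (intro mult_mono frac_le)
      \<comment> \<open>The sine series bound 3 is for sums starting at j = 1; removing that term
        costs at most 1 more.\<close>
      show "\<bar>T\<bar> \<le> 4"
      proof (cases "m = 0")
        case False
        then have "(\<Sum>j=1..m. sin (real j * (N * pi * d)) / real j) = sin (N * pi * d) + T"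
          unfolding T_def by (subst sum.atLeast_Suc_atMost) (auto simp: numeral_2_eq_2)
        moreover have "\<bar>sin (N * pi * d)\<bar> \<le> 1" by simp
        ultimately show ?thesis
          using abs_sine_series_partial_sum_le[of "N * pi * d" m] by linarith
      qed (simp add: T_def)
    qed (use d pi_ge_two in auto)
    finally show ?thesis by simp
  qed
  have "(6 + real (p + q) / (real m + 1)) / d
      = 1 / d + 1 / d + 1 / d * real p / (real m + 1) + 1 / d * real q / (real m + 1) + 4 / d"
    by (simp add: add_divide_distrib mult.commute)
  with 1 2 3 4 5 show ?thesis unfolding m_def[symmetric] by linarith
qed

section \<open>Total contribution of the intervals at a given point\<close>

text \<open>The at most three intervals around cell k0 are estimated singly through \<sigma>. All
  others are translated to the common interval [-h, h], where the lattice bound holds for each s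
  with y = x - t k0 - s, and are then integrated over length 2 h.\<close>

lemma sinc_kernel_sum_inside:
  fixes t :: "nat \<Rightarrow> real"
  assumes B: "\<And>T. \<bar>Si T\<bar> \<le> B" and N: "N \<noteq> 0"
    and d: "0 < d" and h: "0 < h" "h \<le> d / 2"
    and t: "\<And>k. t k = t 0 + real k * d"
    and k0: "k0 \<in> {1..l}" and x: "\<bar>x - t k0\<bar> \<le> d / 2"
    and \<sigma>: "0 < \<sigma>" "\<And>k. k \<in> {1..l} \<Longrightarrow> \<sigma> \<le> \<bar>x - t k\<bar>"
  shows "\<bar>\<Sum>k=1..l. integral {t k - h..t k + h} (\<lambda>s. sinc_kernel N (x - s))\<bar>
          \<le> 3 * ((2 * B + 2) * h / \<sigma>)
             + 2 * h * ((6 + real l / (real (min (k0 - 1) (l - k0)) + 1)) / d)"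
proof -
  define J where "J k = integral {t k - h..t k + h} (\<lambda>s. sinc_kernel N (x - s))" for k
  define p where "p = k0 - 1"
  define q where "q = l - k0"
  \<comment> \<open>The intersection discards the index 0 when k0 = 1 and the index l + 1 when k0 =
    l.\<close>
  define near where "near = {1..l} \<inter> {k0 - 1..k0 + 1}"
  have B0: "0 \<le> B" using B[of 0] by linarith
  have split: "{1..l} = near \<union> ((\<lambda>j. k0 - j) ` {2..p} \<union> (\<lambda>j. k0 + j) ` {2..q})"
  proof (intro equalityI subsetI)
    fix k assume k: "k \<in> {1..l}"
    consider "k \<in> near" | "k + 2 \<le> k0" | "k0 + 2 \<le> k" using k by (force simp: near_def)
    then show "k \<in> near \<union> ((\<lambda>j. k0 - j) ` {2..p} \<union> (\<lambda>j. k0 + j) ` {2..q})"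
    proof cases
      case 2
      then have "k = k0 - (k0 - k)" "k0 - k \<in> {2..p}" using k by (auto simp: p_def)
      then show ?thesis by blast
    next
      case 3
      then have "k = k0 + (k - k0)" "k - k0 \<in> {2..q}" using k by (auto simp: q_def)
      then show ?thesis by blast
    qed simp
  qed (use k0 in \<open>auto simp: near_def p_def q_def\<close>)
  have "(\<Sum>k=1..l. J k) = sum J near + (sum J ((\<lambda>j. k0 - j) ` {2..p}) + sum J ((\<lambda>j. k0 + j) ` {2..q}))"
    unfolding split
    by (subst sum.union_disjoint, auto simp: near_def p_def)+
  also have "sum J ((\<lambda>j. k0 - j) ` {2..p}) = (\<Sum>j=2..p. J (k0 - j))"
    by (subst sum.reindex) (auto simp: inj_on_def p_def)
  also have "sum J ((\<lambda>j. k0 + j) ` {2..q}) = (\<Sum>j=2..q. J (k0 + j))"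
    by (subst sum.reindex) (auto simp: inj_on_def)
  finally have sumJ: "(\<Sum>k=1..l. J k) = sum J near + ((\<Sum>j=2..p. J (k0 - j)) + (\<Sum>j=2..q. J (k0 + j)))" .

  have near: "\<bar>sum J near\<bar> \<le> 3 * ((2 * B + 2) * h / \<sigma>)"
  proof -
    have "\<bar>J k\<bar> \<le> (2 * B + 2) * h / \<sigma>" if "k \<in> near" for k
    proof -
      have k: "\<sigma> \<le> \<bar>x - t k\<bar>" using that \<sigma> by (auto simp: near_def)
      then have "x \<noteq> t k" using \<sigma> by auto
      then have "\<bar>J k\<bar> \<le> (2 * B + 2) * h / \<bar>x - t k\<bar>"
        unfolding J_def by (rule sinc_kernel_integral_single[OF B h(1)])
      also have "\<dots> \<le> (2 * B + 2) * h / \<sigma>"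
        using k \<sigma> B0 h by (intro divide_left_mono mult_pos_pos) auto
      finally show ?thesis .
    qed
    then have "(\<Sum>k\<in>near. \<bar>J k\<bar>) \<le> real (card near) * ((2 * B + 2) * h / \<sigma>)"
      by (rule sum_bounded_above)
    also have "\<dots> \<le> 3 * ((2 * B + 2) * h / \<sigma>)"
    proof (intro mult_right_mono)
      have "card near \<le> card {k0 - 1..k0 + 1}" by (intro card_mono) (auto simp: near_def)
      also have "\<dots> \<le> 3" by simp
      finally show "real (card near) \<le> 3" by simp
    qed (use B0 h \<sigma> in auto)
    finally show ?thesis using sum_abs[of J near] by linarith
  qed

  define F where "F s = (\<Sum>j=2..p. sinc_kernel N (x - t k0 - s + real j * d))
      + (\<Sum>j=2..q. sinc_kernel N (x - t k0 - s - real j * d))" for s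
  have J: "J k = integral {- h..h} (\<lambda>s. sinc_kernel N (x - t k - s))" for k
    unfolding J_def
    using integral_shift_real_ivl[of "t k - h" "t k" "t k + h" "\<lambda>s. sinc_kernel N (x - s)"]
    by (simp add: algebra_simps)
  have tk: "x - t (k0 - j) = x - t k0 + real j * d" if "j \<in> {2..p}" for j
  proof -
    have "real (k0 - j) = real k0 - real j" using that by (auto simp: p_def)
    then show ?thesis using t[of "k0 - j"] t[of k0] by (simp add: algebra_simps)
  qed
  have tk': "x - t (k0 + j) - s = x - t k0 - s - real j * d" for j s
    using t[of "k0 + j"] t[of k0] by (simp add: algebra_simps)
  have "(\<Sum>j=2..p. J (k0 - j)) = integral {- h..h} (\<lambda>s. \<Sum>j=2..p. sinc_kernel N (x - t k0 - s + real j * d))"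
    unfolding J
    by (subst integral_sum)
      (auto intro!: integrable_continuous_real continuous_intros sum.cong simp: tk diff_add_eq)
  moreover have "(\<Sum>j=2..q. J (k0 + j)) = integral {- h..h} (\<lambda>s. \<Sum>j=2..q. sinc_kernel N (x - t k0 - s - real j * d))"
    unfolding J
    by (subst integral_sum)
      (auto intro!: integrable_continuous_real continuous_intros sum.cong simp: tk')
  ultimately have "(\<Sum>j=2..p. J (k0 - j)) + (\<Sum>j=2..q. J (k0 + j)) = integral {- h..h} F"
    unfolding F_def
    by (subst integral_add) (auto intro!: integrable_continuous_real continuous_intros)
  moreover have "norm (integral {- h..h} F)
      \<le> (6 + real l / (real (min p q) + 1)) / d * (h - (- h))"
  proof (rule integral_bound)
    show "continuous_on {- h..h} F" unfolding F_def by (intro continuous_intros)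
    fix s assume s: "s \<in> {- h..h}"
    have "\<bar>x - t k0 - s\<bar> \<le> d" using s x h unfolding atLeastAtMost_iff by linarith
    from sinc_kernel_lattice_sum_le[OF d this N, of p q]
    have "\<bar>F s\<bar> \<le> (6 + real (p + q) / (real (min p q) + 1)) / d" by (simp add: F_def)
    \<comment> \<open>Here p + q = l - 1.\<close>
    also have "\<dots> \<le> (6 + real l / (real (min p q) + 1)) / d"
      using d k0 by (intro divide_right_mono add_left_mono) (auto simp: p_def q_def)
    finally show "norm (F s) \<le> (6 + real l / (real (min p q) + 1)) / d" by simp
  qed (use h in auto)
  ultimately have "\<bar>(\<Sum>j=2..p. J (k0 - j)) + (\<Sum>j=2..q. J (k0 + j))\<bar>
      \<le> 2 * h * ((6 + real l / (real (min p q) + 1)) / d)"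
    by (simp add: mult.commute)
  with near sumJ show ?thesis unfolding J_def[symmetric] p_def q_def by linarith
qed

lemma sinc_kernel_sum_outside:
  fixes t :: "nat \<Rightarrow> real"
  assumes h: "0 < h" and \<rho>: "0 < \<rho>"
    and far: "\<And>k s. k \<in> {1..l} \<Longrightarrow> s \<in> {t k - h..t k + h} \<Longrightarrow> \<rho> \<le> \<bar>x - s\<bar>"
  shows "\<bar>\<Sum>k=1..l. integral {t k - h..t k + h} (\<lambda>s. sinc_kernel N (x - s))\<bar> \<le> 2 * h * real l / \<rho>"
proof -
  have "\<bar>integral {t k - h..t k + h} (\<lambda>s. sinc_kernel N (x - s))\<bar> \<le> 2 * h / \<rho>" if k: "k \<in> {1..l}" for k
  proof -
    have "norm (integral {t k - h..t k + h} (\<lambda>s. sinc_kernel N (x - s))) \<le> 1 / \<rho> * (t k + h - (t k - h))"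
    proof (rule integral_bound)
      fix s assume s: "s \<in> {t k - h..t k + h}"
      have "x - s \<noteq> 0" using far[OF k s] \<rho> by auto
      then have "\<bar>sinc_kernel N (x - s)\<bar> \<le> 1 / (pi * \<bar>x - s\<bar>)" by (rule abs_sinc_kernel_le)
      also have "\<dots> \<le> 1 / (1 * \<rho>)"
        using far[OF k s] \<rho> pi_ge_two by (intro frac_le mult_mono) auto
      finally show "norm (sinc_kernel N (x - s)) \<le> 1 / \<rho>" by simp
    qed (use h in \<open>auto intro!: continuous_intros\<close>)
    then show ?thesis by simp
  qed
  then have "(\<Sum>k=1..l. \<bar>integral {t k - h..t k + h} (\<lambda>s. sinc_kernel N (x - s))\<bar>)
      \<le> real (card {1..l}) * (2 * h / \<rho>)"
    by (rule sum_bounded_above)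
  then show ?thesis
    by (intro order_trans[OF sum_abs]) (simp add: mult_ac)
qed

text \<open>For s in [0, 1] the quantity 1 - |x - s| is at least min x (1 - x) \<ge> \<rho>, so the
  kernels differ by at most 2 / \<rho> on a total length of 2 h l.\<close>

lemma dirichlet_sinc_integral_sum_diff:
  fixes t :: "nat \<Rightarrow> real"
  assumes h: "0 < h" and \<rho>: "0 < \<rho>" "\<rho> \<le> x" "\<rho> \<le> 1 - x"
    and t: "\<And>k. k \<in> {1..l} \<Longrightarrow> {t k - h..t k + h} \<subseteq> {0..1}"
  shows "\<bar>(\<Sum>k=1..l. integral {t k - h..t k + h} (\<lambda>s. dirichlet_kernel n (x - s)))
            - (\<Sum>k=1..l. integral {t k - h..t k + h} (\<lambda>s. sinc_kernel (2 * real n + 1) (x - s)))\<bar>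
          \<le> 2 * (2 * h * real l / \<rho>)"
proof -
  define E where "E s = dirichlet_kernel n (x - s) - sinc_kernel (2 * real n + 1) (x - s)" for s
  have "\<bar>integral {t k - h..t k + h} E\<bar> \<le> 4 * h / \<rho>" if k: "k \<in> {1..l}" for k
  proof -
    have "norm (integral {t k - h..t k + h} E) \<le> 2 / \<rho> * (t k + h - (t k - h))"
    proof (rule integral_bound)
      fix s assume s: "s \<in> {t k - h..t k + h}"
      then have "0 \<le> s" "s \<le> 1" using t[OF k] by auto
      then have u: "\<rho> \<le> 1 - \<bar>x - s\<bar>" using \<rho> by auto
      have "\<bar>E s\<bar> \<le> 2 / (1 - \<bar>x - s\<bar>)"
        unfolding E_def using u \<rho> by (intro dirichlet_sinc_kernel_diff) auto
      also have "\<dots> \<le> 2 / \<rho>" using u \<rho> by (intro divide_left_mono) auto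
      finally show "norm (E s) \<le> 2 / \<rho>" by simp
    qed (use h in \<open>auto simp: E_def intro!: continuous_intros\<close>)
    then show ?thesis by simp
  qed
  then have "(\<Sum>k=1..l. \<bar>integral {t k - h..t k + h} E\<bar>) \<le> real (card {1..l}) * (4 * h / \<rho>)"
    by (rule sum_bounded_above)
  moreover have "integral {t k - h..t k + h} E
      = integral {t k - h..t k + h} (\<lambda>s. dirichlet_kernel n (x - s))
        - integral {t k - h..t k + h} (\<lambda>s. sinc_kernel (2 * real n + 1) (x - s))" for k
    unfolding E_def by (intro integral_diff integrable_continuous_real continuous_intros)
  ultimately show ?thesis
    using sum_abs[of "\<lambda>k. integral {t k - h..t k + h} E" "{1..l}"]
    by (simp add: sum_subtractf mult_ac)
qed

subsection \<open>The set \<open>G\<close>\<close>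

locale comb =
  fixes a b :: real and l :: nat and \<epsilon> :: real
  assumes a: "0 \<le> a" and ab: "a < b" and b: "b \<le> 1" and l: "1 \<le> l" and \<epsilon>: "0 < \<epsilon>" "\<epsilon> < 1"
begin

definition "d = (b - a) / real l"
text \<open>Half the length of one of the l intervals, so that the measure of \<open>G\<close> is 2
  h l.\<close>

definition "h = d * \<epsilon> / 2"

abbreviation "t \<equiv> G_center a b l"
abbreviation "G \<equiv> G_set l a b \<epsilon>"

lemma d_pos: "0 < d" and l_times_d: "real l * d = b - a"
  using ab l by (simp_all add: d_def)

lemma h_pos: "0 < h" and h_less: "h < d / 2"
  using d_pos \<epsilon> by (simp_all add: h_def)

lemma center_eq: "t k = a + (real k - 1 / 2) * d"
  by (simp add: G_center_def d_def field_simps)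

lemma G_delta_eq: "G_delta a b l \<epsilon> k = {t k - h..<t k + h}"
  by (simp add: G_delta_def Let_def h_def d_def)

lemma center_bounds:
  assumes "k \<in> {1..l}"
  shows "a + d / 2 \<le> t k" "t k \<le> b - d / 2"
proof -
  have "d \<le> real k * d" "real k * d \<le> real l * d"
    using assms d_pos by (auto simp: mult_right_mono)
  then show "a + d / 2 \<le> t k" "t k \<le> b - d / 2"
    using l_times_d by (auto simp: center_eq algebra_simps)
qed

lemma closed_interval_subset: "k \<in> {1..l} \<Longrightarrow> {t k - h..t k + h} \<subseteq> {a..b}"
  using center_bounds[of k] h_less by auto

lemma interval_subset: "k \<in> {1..l} \<Longrightarrow> {t k - h..<t k + h} \<subseteq> {0..<1}"
  using center_bounds[of k] h_less a b by auto

lemma disjoint_intervals: "disjoint_family_on (\<lambda>k. {t k - h..<t k + h}) I"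
proof -
  have "{t i - h..<t i + h} \<inter> {t j - h..<t j + h} = {}" if "i < j" for i j
  proof -
    have "real i + 1 \<le> real j" using that by linarith
    then have "(real i + 1) * d \<le> real j * d" using d_pos by (intro mult_right_mono) auto
    then have "t i + d \<le> t j" by (simp add: center_eq algebra_simps)
    then show ?thesis using h_less by auto
  qed
  then show ?thesis
    by (auto simp: disjoint_family_on_def) (metis Int_iff empty_iff atLeastLessThan_iff nat_neq_iff)
qed

lemma G_eq: "G = (\<Union>k\<in>{1..l}. {t k - h..<t k + h})"
  by (simp add: G_set_def G_delta_eq)

lemma measure_G: "measure lebesgue G = 2 * h * real l"
proof -
  have "measure lebesgue G = (\<Sum>k=1..l. measure lebesgue {t k - h..<t k + h})"
    unfolding G_eq using disjoint_intervals h_pos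
    by (intro measure_finite_Union) auto
  then show ?thesis using h_pos by simp
qed

section \<open>Fourier coefficients and partial sums of the indicator of \<open>G\<close>\<close>

lemma fourier_coeff_G:
  "fourier_coeff (indicator G) j
     = (\<Sum>k=1..l. integral {t k - h..t k + h} (\<lambda>s. exp (- (2 * of_real pi * \<i> * of_int j * of_real s))))"
proof -
  define e :: "real \<Rightarrow> complex" where "e s = exp (- (2 * of_real pi * \<i> * of_int j * of_real s))" for s
  have cont: "continuous_on S e" for S unfolding e_def by (intro continuous_intros)
  have int: "set_integrable lebesgue {t k - h..<t k + h} e" for k
  proof -
    have "set_integrable lebesgue {t k - h..t k + h} e"
      by (intro absolutely_integrable_continuous_real cont)
    then show ?thesis by (rule set_integrable_subset) auto
  qed
  \<comment> \<open>Passing to gauge integrals over closed intervals, which differ from the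
    half-open ones in a single point, prepares for the antiderivative \<open>Si\<close>.\<close>
  have piece: "(LINT s:{t k - h..<t k + h}|lebesgue. e s) = integral {t k - h..t k + h} e" for k
  proof -
    have "(LINT s:{t k - h..<t k + h}|lebesgue. e s) = integral {t k - h..<t k + h} e"
      by (rule set_lebesgue_integral_eq_integral(2)[OF int])
    also have "\<dots> = integral {t k - h..t k + h} e"
      by (rule integral_subset_negligible) (auto intro: negligible_subset[of "{t k + h}"])
    finally show ?thesis .
  qed
  have ind: "indicator G s = (\<Sum>k=1..l. indicator {t k - h..<t k + h} s :: complex)" for s
    unfolding G_eq using disjoint_intervals by (intro indicator_UN_disjoint) auto
  have "fourier_coeff (indicator G) j = (LINT s|lebesgue. (\<Sum>k=1..l. indicator {t k - h..<t k + h} s *\<^sub>R e s))"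
    unfolding fourier_coeff_def set_lebesgue_integral_def e_def[symmetric] ind
  proof (intro Bochner_Integration.integral_cong refl)
    fix s
    have "indicator {0..<1} s *\<^sub>R ((indicator {t k - h..<t k + h} s :: complex) * e s)
        = indicator {t k - h..<t k + h} s *\<^sub>R e s" if "k \<in> {1..l}" for k
      using interval_subset[OF that] by (auto simp: indicator_def)
    then show "indicator {0..<1} s *\<^sub>R ((\<Sum>k=1..l. indicator {t k - h..<t k + h} s) * e s)
        = (\<Sum>k=1..l. indicator {t k - h..<t k + h} s *\<^sub>R e s)"
      unfolding sum_distrib_right scaleR_right.sum by (intro sum.cong) auto
  qed
  also have "\<dots> = (\<Sum>k=1..l. LINT s:{t k - h..<t k + h}|lebesgue. e s)"
    using int unfolding set_lebesgue_integral_def set_integrable_def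
    by (intro Bochner_Integration.integral_sum) auto
  also have "\<dots> = (\<Sum>k=1..l. integral {t k - h..t k + h} e)"
    by (simp only: piece)
  finally show ?thesis by (simp only: e_def[abs_def])
qed

text \<open>Interchanging sums and integrals gives the convolution with the Dirichlet kernel. The
  result is real, so real estimates control its modulus.\<close>

lemma fourier_partial_sum_G:
  "fourier_partial_sum n x (indicator G)
     = complex_of_real (\<Sum>k=1..l. integral {t k - h..t k + h} (\<lambda>s. dirichlet_kernel n (x - s)))"
proof -
  define e :: "int \<Rightarrow> real \<Rightarrow> complex" where "e j u = exp (2 * of_real pi * \<i> * of_int j * of_real u)" for j u
  have cont: "continuous_on S (\<lambda>s. e j (x - s))" for S j unfolding e_def by (intro continuous_intros)
  have "fourier_partial_sum n x (indicator G)
      = (\<Sum>j\<in>{- int n..int n}. \<Sum>k=1..l. integral {t k - h..t k + h} (\<lambda>s. e j (x - s)))"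
  proof -
    have "integral S (\<lambda>s. exp (- (2 * of_real pi * \<i> * of_int j * of_real s)))
        * exp (2 * of_real pi * \<i> * of_int j * of_real x) = integral S (\<lambda>s. e j (x - s))" for S j
      unfolding integral_mult_left[symmetric] e_def
      by (intro integral_cong) (simp add: exp_add[symmetric] algebra_simps)
    then show ?thesis
      unfolding fourier_partial_sum_def fourier_coeff_G sum_distrib_right by simp
  qed
  also have "\<dots> = (\<Sum>k=1..l. \<Sum>j\<in>{- int n..int n}. integral {t k - h..t k + h} (\<lambda>s. e j (x - s)))"
    by (rule sum.swap)
  also have "\<dots> = (\<Sum>k=1..l. integral {t k - h..t k + h} (\<lambda>s. \<Sum>j\<in>{- int n..int n}. e j (x - s)))"
    by (intro sum.cong refl integral_sum[symmetric] integrable_continuous_real cont) auto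
  also have "\<dots> = (\<Sum>k=1..l. integral {t k - h..t k + h} (\<lambda>s. complex_of_real (dirichlet_kernel n (x - s))))"
    unfolding e_def exp_sum_eq_dirichlet_kernel ..
  also have "\<dots> = (\<Sum>k=1..l. complex_of_real (integral {t k - h..t k + h} (\<lambda>s. dirichlet_kernel n (x - s))))"
    by (intro sum.cong refl integral_linear[OF _ bounded_linear_of_real, unfolded o_def]
        integrable_continuous_real continuous_intros)
  finally show ?thesis by simp
qed

section \<open>Pointwise bound and weak-type estimate\<close>

lemma nearest_center:
  assumes x: "a \<le> x" "x < b"
  obtains k where "k \<in> {1..l}" "\<bar>x - t k\<bar> \<le> d / 2" "x - a \<le> real k * d" "b - x \<le> (real l - real k + 1) * d"
proof -
  \<comment> \<open>The floor counts cells from 0 and the centers are numbered from 1.\<close>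
  define k where "k = nat \<lfloor>(x - a) / d\<rfloor> + 1"
  have "0 \<le> (x - a) / d" using x d_pos by simp
  then have k: "real k - 1 \<le> (x - a) / d" "(x - a) / d < real k"
    unfolding k_def by linarith+
  then have k': "(real k - 1) * d \<le> x - a" "x - a < real k * d"
    using d_pos by (simp_all add: field_simps)
  have "(real k - 1) * d < real l * d" using k' x l_times_d by linarith
  then have "real k - 1 < real l" using d_pos by simp
  then have "k \<in> {1..l}" by (auto simp: k_def)
  moreover have "\<bar>x - t k\<bar> \<le> d / 2" 
  proof -
    have "t k = a + (real k - 1) * d + d / 2" "t k = a + real k * d - d / 2"
      by (simp_all add: center_eq algebra_simps)
    with k' show ?thesis by linarith
  qed
  moreover have "b - x \<le> (real l - real k + 1) * d" using k' l_times_d by (simp add: algebra_simps)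
  ultimately show ?thesis using k' that by simp
qed

text \<open>Two of the three multiples of 2 h l / \<rho> come from replacing the Dirichlet kernel;
  the third comes from the whole sinc sum if x lies outside [a, b), and from the unpaired terms if
  it lies inside. The \<sigma> term is due to the nearby intervals and 6 \<epsilon> to the paired
  ones. As n does not occur, the bound passes to the supremum.\<close>

lemma fourier_partial_sum_le:
  assumes B: "\<And>T. \<bar>Si T\<bar> \<le> B"
    and \<rho>: "0 < \<rho>" "\<rho> \<le> x" "\<rho> \<le> 1 - x" "\<rho> \<le> \<bar>x - a\<bar>" "\<rho> \<le> \<bar>x - b\<bar>"
    and \<sigma>: "0 < \<sigma>" "\<And>k. k \<in> {1..l} \<Longrightarrow> \<sigma> \<le> \<bar>x - t k\<bar>"
  shows "cmod (fourier_partial_sum n x (indicator G))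
          \<le> 3 * (2 * h * real l / \<rho>) + 6 * (B + 1) * (h / \<sigma>) + (if x \<in> {a..<b} then 6 * \<epsilon> else 0)"
proof -
  define N where "N = 2 * real n + 1"
  define Q where "Q = (\<Sum>k=1..l. integral {t k - h..t k + h} (\<lambda>s. sinc_kernel N (x - s)))"
  have B0: "0 \<le> B" using B[of 0] by linarith
  have \<sigma>0: "0 \<le> 6 * (B + 1) * (h / \<sigma>)" using B0 h_pos \<sigma> by simp
  have "\<bar>(\<Sum>k=1..l. integral {t k - h..t k + h} (\<lambda>s. dirichlet_kernel n (x - s))) - Q\<bar>
      \<le> 2 * (2 * h * real l / \<rho>)"
    unfolding Q_def N_def
  proof (rule dirichlet_sinc_integral_sum_diff[OF h_pos \<rho>(1-3)])
    fix k assume "k \<in> {1..l}"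
    then show "{t k - h..t k + h} \<subseteq> {0..1}" using closed_interval_subset[of k] a b by auto
  qed
  moreover have "\<bar>Q\<bar> \<le> 2 * h * real l / \<rho> + 6 * (B + 1) * (h / \<sigma>) + (if x \<in> {a..<b} then 6 * \<epsilon> else 0)"
  proof (cases "x \<in> {a..<b}")
    case False
    have "\<bar>Q\<bar> \<le> 2 * h * real l / \<rho>"
      unfolding Q_def
    proof (rule sinc_kernel_sum_outside[OF h_pos \<rho>(1)])
      fix k s assume "k \<in> {1..l}" "s \<in> {t k - h..t k + h}"
      then have "s \<in> {a..b}" using closed_interval_subset by blast
      then show "\<rho> \<le> \<bar>x - s\<bar>" using False \<rho> by auto
    qed
    then show ?thesis using False \<sigma>0 by auto
  next
    case True
    then obtain k0 where k0: "k0 \<in> {1..l}" "\<bar>x - t k0\<bar> \<le> d / 2"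
        "x - a \<le> real k0 * d" "b - x \<le> (real l - real k0 + 1) * d"
      using nearest_center[of x] by auto
    define m where "m = min (k0 - 1) (l - k0)"
    have "\<bar>Q\<bar> \<le> 3 * ((2 * B + 2) * h / \<sigma>) + 2 * h * ((6 + real l / (real m + 1)) / d)"
      unfolding Q_def m_def
    proof (rule sinc_kernel_sum_inside[OF B _ d_pos h_pos])
      \<comment> \<open>The point \<open>t 0\<close> is the center of a fictitious cell to the left
        of a; it serves only as origin of the progression.\<close>
      show "t k = t 0 + real k * d" for k by (simp add: center_eq algebra_simps)
    qed (use k0 \<sigma> h_less in \<open>auto simp: N_def\<close>)
    moreover have "3 * ((2 * B + 2) * h / \<sigma>) = 6 * (B + 1) * (h / \<sigma>)"
      by (simp add: algebra_simps add_divide_distrib)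
    moreover have "2 * h * ((6 + real l / (real m + 1)) / d) = 6 * \<epsilon> + 2 * h * real l / ((real m + 1) * d)"
    proof -
      have "2 * h * ((6 + real l / (real m + 1)) / d) = 6 * (2 * h / d) + 2 * h * (real l / (real m + 1)) / d"
        by (simp add: add_divide_distrib distrib_left)
      moreover have "2 * h / d = \<epsilon>" using d_pos by (simp add: h_def)
      ultimately show ?thesis by simp
    qed
    moreover have "2 * h * real l / ((real m + 1) * d) \<le> 2 * h * real l / \<rho>"
    proof -
      \<comment> \<open>Since m + 1 = min k0 (l - k0 + 1), the right side is at least the distance
        from x to a or to b.\<close>
      have "\<rho> \<le> (real m + 1) * d"
        using \<rho> True k0 by (cases "k0 - 1 \<le> l - k0") (auto simp: m_def of_nat_diff algebra_simps)
      then show ?thesis using \<rho> h_pos d_pos by (intro divide_left_mono) auto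
    qed
    ultimately have "\<bar>Q\<bar> \<le> 2 * h * real l / \<rho> + 6 * (B + 1) * (h / \<sigma>) + 6 * \<epsilon>" by linarith
    then show ?thesis using True by simp
  qed
  ultimately show ?thesis
    unfolding fourier_partial_sum_G norm_of_real by linarith
qed

text \<open>Outside the exceptional set \<open>U\<close> the three parts of the pointwise bound are
  at most lam/4, lam/4 and lam/2. The measure of \<open>U\<close> is at most 96 + 24 (B + 1) + 12
  times |G| / lam: four intervals of length 2 \<rho>, l intervals of length 2 \<sigma>, and
  \<open>D\<close>.\<close>

lemma fourier_maximal_weak_type:
  assumes B: "\<And>T. \<bar>Si T\<bar> \<le> B" and lam: "0 < lam"
  shows "measure lebesgue {x \<in> {0..<1}. fourier_maximal x (indicator G) > ereal lam}
          \<le> (132 + 24 * B) * (measure lebesgue G / lam)"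
proof -
  define M where "M = measure lebesgue G"
  \<comment> \<open>The radii are chosen so that 3 M / \<rho> and 6 (B + 1) h / \<sigma> both equal
    lam/4.\<close>
  define \<rho> where "\<rho> = 12 * M / lam"
  define \<sigma> where "\<sigma> = 24 * (B + 1) * h / lam"
  define I where "I r p = {p - r..p + r}" for r p :: real
  \<comment> \<open>When 6 \<epsilon> exceeds lam/2 the whole interval is given up; its length M /
    \<epsilon> is then below 12 M / lam.\<close>
  define D where "D = (if lam < 12 * \<epsilon> then {a..b} else {})"
  define U where "U = (\<Union>p\<in>{0, 1, a, b}. I \<rho> p) \<union> (\<Union>k\<in>{1..l}. I \<sigma> (t k)) \<union> D"
  have B0: "0 \<le> B" using B[of 0] by linarith
  have M: "M = 2 * h * real l" by (simp add: M_def measure_G)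
  then have M0: "0 < M" using h_pos l by simp
  have M_eps: "M = \<epsilon> * (b - a)" using l by (simp add: M h_def d_def)
  have \<rho>0: "0 < \<rho>" using M0 lam by (simp add: \<rho>_def)
  have \<sigma>0: "0 < \<sigma>" using B0 h_pos lam by (simp add: \<sigma>_def)
  have meas: "I r p \<in> lmeasurable" "D \<in> lmeasurable" for r p by (auto simp: I_def D_def)
  then have U: "U \<in> lmeasurable" unfolding U_def by (intro fmeasurable.Un fmeasurable.finite_UN) auto
  have sub: "{x \<in> {0..<1}. fourier_maximal x (indicator G) > ereal lam} \<subseteq> U"
  proof
    fix x assume x: "x \<in> {x \<in> {0..<1}. fourier_maximal x (indicator G) > ereal lam}"
    show "x \<in> U"
    proof (rule ccontr)
      assume "x \<notin> U"
      then have out: "x \<notin> I \<rho> 0" "x \<notin> I \<rho> 1" "x \<notin> I \<rho> a" "x \<notin> I \<rho> b"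
          "\<And>k. k \<in> {1..l} \<Longrightarrow> x \<notin> I \<sigma> (t k)" "x \<notin> D"
        by (auto simp: U_def)
      have bound: "cmod (fourier_partial_sum n x (indicator G)) \<le> lam" for n
      proof -
        have "cmod (fourier_partial_sum n x (indicator G))
            \<le> 3 * (2 * h * real l / \<rho>) + 6 * (B + 1) * (h / \<sigma>) + (if x \<in> {a..<b} then 6 * \<epsilon> else 0)"
        proof (rule fourier_partial_sum_le[OF B \<rho>0 _ _ _ _ \<sigma>0])
          fix k assume "k \<in> {1..l}"
          from out(5)[OF this] show "\<sigma> \<le> \<bar>x - t k\<bar>" by (auto simp: I_def)
        qed (use out x in \<open>auto simp: I_def\<close>)
        moreover have "3 * (2 * h * real l / \<rho>) = lam / 4"
          using M0 lam unfolding M[symmetric] by (simp add: \<rho>_def)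
        moreover have "6 * (B + 1) * (h / \<sigma>) = lam / 4"
          using B0 h_pos lam by (simp add: \<sigma>_def divide_simps)
        moreover have "(if x \<in> {a..<b} then 6 * \<epsilon> else 0) \<le> lam / 2"
          using out(6) lam by (auto simp: D_def split: if_splits)
        ultimately show ?thesis by linarith
      qed
      have "fourier_maximal x (indicator G) \<le> ereal lam"
        unfolding fourier_maximal_def using bound by (intro SUP_least) simp
      with x show False by auto
    qed
  qed
  have mI: "measure lebesgue (I r p) = 2 * r" if "0 < r" for r p using that by (simp add: I_def)
  have "measure lebesgue {x \<in> {0..<1}. fourier_maximal x (indicator G) > ereal lam} \<le> measure lebesgue U"
  proof (cases "{x \<in> {0..<1}. fourier_maximal x (indicator G) > ereal lam} \<in> sets lebesgue")
    case True
    then show ?thesis using sub U by (intro measure_mono_fmeasurable)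
  next
    \<comment> \<open>A set that is not measurable has \<open>measure\<close> 0 by convention, so
      measurability of the level set need not be shown.\<close>
    case False
    then show ?thesis by (simp add: measure_notin_sets)
  qed
  also have "\<dots> \<le> measure lebesgue ((\<Union>p\<in>{0, 1, a, b}. I \<rho> p) \<union> (\<Union>k\<in>{1..l}. I \<sigma> (t k))) + measure lebesgue D"
    unfolding U_def using meas by (intro measure_Un_le) (auto intro!: fmeasurableD)
  also have "measure lebesgue ((\<Union>p\<in>{0, 1, a, b}. I \<rho> p) \<union> (\<Union>k\<in>{1..l}. I \<sigma> (t k)))
      \<le> measure lebesgue (\<Union>p\<in>{0, 1, a, b}. I \<rho> p) + measure lebesgue (\<Union>k\<in>{1..l}. I \<sigma> (t k))"
    using meas by (intro measure_Un_le) (auto intro!: fmeasurableD)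
  also have "measure lebesgue (\<Union>p\<in>{0, 1, a, b}. I \<rho> p) \<le> 8 * \<rho>"
  proof -
    have "measure lebesgue (\<Union>p\<in>{0, 1, a, b}. I \<rho> p) \<le> (\<Sum>p\<in>{0, 1, a, b}. measure lebesgue (I \<rho> p))"
      using meas by (intro measure_UNION_le) (auto intro!: fmeasurableD)
    also have "\<dots> = real (card {0, 1, a, b}) * (2 * \<rho>)" using mI[OF \<rho>0] by simp
    also have "\<dots> \<le> 4 * (2 * \<rho>)"
    proof (intro mult_right_mono)
      \<comment> \<open>The four points may coincide, for instance when a = 0.\<close>
      have "card {0, 1, a, b} \<le> 4" using card_length[of "[0, 1, a, b]"] by simp
      then show "real (card {0, 1, a, b}) \<le> 4" by linarith
    qed (use \<rho>0 in auto)
    finally show ?thesis by simp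
  qed
  also have "measure lebesgue (\<Union>k\<in>{1..l}. I \<sigma> (t k)) \<le> 2 * \<sigma> * real l"
  proof -
    have "measure lebesgue (\<Union>k\<in>{1..l}. I \<sigma> (t k)) \<le> (\<Sum>k\<in>{1..l}. measure lebesgue (I \<sigma> (t k)))"
      using meas by (intro measure_UNION_le) (auto intro!: fmeasurableD)
    then show ?thesis using mI[OF \<sigma>0] by (simp add: mult.commute)
  qed
  also have "2 * \<sigma> * real l = 24 * (B + 1) * (M / lam)"
    by (simp add: \<sigma>_def M)
  also have "measure lebesgue D \<le> 12 * (M / lam)"
  proof (cases "lam < 12 * \<epsilon>")
    case True
    then have "lam * (b - a) \<le> 12 * \<epsilon> * (b - a)" using ab by (intro mult_right_mono) auto
    then show ?thesis using True ab lam by (simp add: D_def M_eps field_simps)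
  qed (use M0 lam in \<open>simp add: D_def\<close>)
  also have "8 * \<rho> = 96 * (M / lam)" by (simp add: \<rho>_def)
  finally have "measure lebesgue {x \<in> {0..<1}. fourier_maximal x (indicator G) > ereal lam}
      \<le> 96 * (M / lam) + 24 * (B + 1) * (M / lam) + 12 * (M / lam)" by linarith
  also have "\<dots> = (132 + 24 * B) * (M / lam)" by (simp add: algebra_simps)
  finally show ?thesis unfolding M_def .
qed

end

theorem proposition1:
  shows "\<exists>c::real. c > 0 \<and>
    (\<forall>(a::real) (b::real) (l::nat) (\<epsilon>::real) (lam::real).
       0 \<le> a \<longrightarrow> a < b \<longrightarrow> b \<le> 1 \<longrightarrow> l \<ge> 1 \<longrightarrow> 0 < \<epsilon> \<longrightarrow> \<epsilon> < 1 \<longrightarrow> lam > 0 \<longrightarrow>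
       measure lebesgue
         {x \<in> {0..<1}. fourier_maximal x (indicator (G_set l a b \<epsilon>)) > ereal lam}
       \<le> c * (measure lebesgue (G_set l a b \<epsilon>) / lam))"
proof -
  \<comment> \<open>The bound of the sine integral is the only ingredient of c that is not
    explicit.\<close>
  obtain B where B: "\<And>T. \<bar>Si T\<bar> \<le> B" using bounded_Si by auto
  have "0 \<le> B" using B[of 0] by linarith
  then show ?thesis
    using comb.fourier_maximal_weak_type[OF comb.intro B]
    by (intro exI[of _ "132 + 24 * B"]) auto
qed

end
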